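(* Let user affinities be uniformly distributed, $A\sim\mathrm{Uni}[0,1]$, and let $x^\circ=\frac{c-1}{e-1}$. The set $\mathcal X$ of equilibria is: Case 1: if $c>1$ and $c>e$, then $\mathcal X=\{0\}$; Case 2: if $e<c<1$, then $\mathcal X=\{x^\circ\}$; Case 3: if $1<c<e$, then $\mathcal X=\{0,x^\circ,1\}$; Case 4: if $c<1$ and $c<e$, then $\mathcal X=\{1\}$. Besides these main cases there are the edge cases: (i) $\mathcal X=[0,1]$ for $c=e=1$; (ii) $\mathcal X=\{0\}$ for $e<c=1$; (iii) $\mathcal X=\{1\}$ for $c=e<1$; (iv) $\mathcal X=\{0,1\}$ for $1<c=e$ and for $c=1<e$. All equilibria are stable, i.e. $\mathcal X=\bar{\mathcal X}$, except $x^\circ$ in case 3.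
   Context: $c\ge0$ is the nominal service cost and $e\ge0$ the externality parameter. For adoption level $x\in[0,1]$ put $f(x,0)=\bar F_A(c-ex)-x$, where $\bar F_A(a)=\mathbb{P}(A>a)$ is the complementary CDF of the user affinity $A$. The unsubsidized adoption dynamics are $\dot x(t)=\gamma f(x(t),0)$ with $\gamma>0$. An adoption level $x\in[0,1]$ is an equilibrium if $f(x,0)=0$; $\mathcal X$ is the set of equilibria. An equilibrium $x$ is stable if $\frac{d}{dx}f(x,0)<0$; $\bar{\mathcal X}\subseteq\mathcal X$ is the set of stable equilibria.
   Formalization: The claim that all equilibria are stable except x° in case 3 fails in edge cases (i) and (iv); there it is corrected: for c=e=1 no equilibrium is stable, and in (iv) x° (equal to 1 if 1<c=e, to 0 if c=1<e) is unstable, the other stable. Derivatives at 0 and 1 are one-sided. *)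

theory Defs
  imports "HOL-Probability.Probability"
begin

definition ccdf :: "'w measure \<Rightarrow> ('w \<Rightarrow> real) \<Rightarrow> real \<Rightarrow> real" where
  "ccdf M A a = measure M {w \<in> space M. A w > a}"

text \<open>The function f(x,0), i.e. the drift of the adoption level without subsidies. The rate
  constant of the dynamics only rescales time and enters neither equilibria nor stability.\<close>

definition drift :: "'w measure \<Rightarrow> ('w \<Rightarrow> real) \<Rightarrow> real \<Rightarrow> real \<Rightarrow> real \<Rightarrow> real" where
  "drift M A c e x = ccdf M A (c - e * x) - x"

definition equilibria :: "'w measure \<Rightarrow> ('w \<Rightarrow> real) \<Rightarrow> real \<Rightarrow> real \<Rightarrow> real set" where
  "equilibria M A c e = {x \<in> {0..1}. drift M A c e x = 0}"

text \<open>Adoption levels range over [0,1], so the derivative at the end points 0 and 1 is the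
  one-sided derivative from inside [0,1].\<close>

definition stable_equilibria :: "'w measure \<Rightarrow> ('w \<Rightarrow> real) \<Rightarrow> real \<Rightarrow> real \<Rightarrow> real set" where
  "stable_equilibria M A c e =
     {x \<in> equilibria M A c e.
        \<exists>D<0. (drift M A c e has_real_derivative D) (at x within {0..1})}"

definition x_circ :: "real \<Rightarrow> real \<Rightarrow> real" where
  "x_circ c e = (c - 1) / (e - 1)"

end

theory Submission
  imports Defs
begin

text \<open>For uniform affinities the drift is the affine function \<open>1 - c + e * x\<close> clamped to \<open>[0,1]\<close>,
  minus \<open>x\<close>. Its zeros in \<open>[0,1]\<close> are 0 (if clamped from below), 1 (if clamped from above) and the
  fixed points of the affine function. Strictly inside a clamped region the slope is \<open>-1\<close>; near a
  fixed point, points of \<open>[0,1]\<close> stay in the unclamped region (as \<open>e \<ge> 0\<close>), even if the fixed point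
  is 0 or 1, and there the slope is \<open>e - 1\<close>.\<close>

text \<open>The distribution function of a uniform variable is known on \<open>[0,1]\<close>;
  monotonicity together with the bounds 0 and 1 on probabilities forces its values outside.\<close>

lemma (in prob_space) ccdf_uniform:
  fixes A :: "'a \<Rightarrow> real"
  assumes D: "distributed M lborel A (\<lambda>x. indicator {0..1::real} x / measure lborel {0..1::real})"
  shows "ccdf M A a = max 0 (min 1 (1 - a))"
proof -
  have [measurable]: "A \<in> borel_measurable M"
    using distributed_measurable[OF D] by simp
  let ?F = "\<lambda>t. measure M {w \<in> space M. A w \<le> t}"
  have mono: "?F s \<le> ?F t" if "s \<le> t" for s t
    using that by (intro finite_measure_mono) auto
  have F: "?F t = t" if "0 \<le> t" "t \<le> 1" for t
    using uniform_distributed_measure[OF D] that by simp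
  have "?F a = max 0 (min 1 a)"
  proof -
    consider "a < 0" | "0 \<le> a" "a \<le> 1" | "1 < a" by linarith
    then show ?thesis
    proof cases
      case 1
      then show ?thesis using mono[of a 0] F[of 0] measure_nonneg[of M "{w \<in> space M. A w \<le> a}"]
        by simp
    next
      case 2
      then show ?thesis using F by simp
    next
      case 3
      then show ?thesis using mono[of 1 a] F[of 1] prob_le_1[of "{w \<in> space M. A w \<le> a}"]
        by simp
    qed
  qed
  moreover have "{w \<in> space M. A w > a} = space M - {w \<in> space M. A w \<le> a}"
    by auto
  moreover have "prob (space M - {w \<in> space M. A w \<le> a}) = 1 - ?F a"
    by (rule prob_compl) measurable
  ultimately show ?thesis
    unfolding ccdf_def by simp
qed

text \<open>Every point of \<open>[0,1]\<close>, end points included, is a limit point of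
  \<open>[0,1]\<close>, so the derivative within this interval is unique and the local slope
  \<open>p\<close> alone decides stability.\<close>

lemma stable_equilibria_iff_slope:
  assumes eq: "x \<in> equilibria M A c e" and "d > 0"
    and affine: "\<And>y. y \<in> {0..1} \<Longrightarrow> \<bar>y - x\<bar> < d \<Longrightarrow> drift M A c e y = p * y + q"
  shows "x \<in> stable_equilibria M A c e \<longleftrightarrow> p < 0"
proof -
  have x: "x \<in> {0..1}" using eq by (simp add: equilibria_def)
  have "((\<lambda>y. p * y + q) has_real_derivative p) (at x within {0..1})"
    by (auto intro!: derivative_eq_intros)
  then have deriv: "(drift M A c e has_real_derivative p) (at x within {0..1})"
    by (rule has_field_derivative_transform_within[OF _ \<open>d > 0\<close> x])
      (simp add: affine dist_real_def)
  have "D = p" if "(drift M A c e has_real_derivative D) (at x within {0..1})" for D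
    using that deriv x
    by (intro vector_derivative_unique_within[of x "{0..1}"])
      (auto simp: trivial_limit_within has_real_derivative_iff_has_vector_derivative)
  with deriv eq show ?thesis
    unfolding stable_equilibria_def by blast
qed

locale uniform_adoption = prob_space M for M :: "'w measure" +
  fixes A :: "'w \<Rightarrow> real" and c e :: real
  assumes uniform:
      "distributed M lborel A (\<lambda>x. indicator {0..1::real} x / measure lborel {0..1::real})"
    and e_nonneg: "e \<ge> 0"
begin

lemma drift_eq: "drift M A c e x = max 0 (min 1 (1 - c + e * x)) - x"
  by (simp add: drift_def ccdf_uniform[OF uniform] algebra_simps)

lemma mem_equilibria_iff:
  "x \<in> equilibria M A c e \<longleftrightarrow>
     x \<in> {0..1} \<and> (x = 0 \<and> 1 \<le> c \<or> x = 1 \<and> c \<le> e \<or> (e - 1) * x = c - 1)"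
proof -
  have "max 0 (min 1 u) = x \<longleftrightarrow> x = 0 \<and> u \<le> 0 \<or> x = 1 \<and> 1 \<le> u \<or> u = x"
    if "0 \<le> x" "x \<le> 1" for u :: real
    using that by (auto simp: max_def min_def)
  from this[of "1 - c + e * x"] have "x \<in> equilibria M A c e \<longleftrightarrow>
      x \<in> {0..1} \<and> (x = 0 \<and> 1 - c + e * x \<le> 0 \<or> x = 1 \<and> 1 \<le> 1 - c + e * x \<or>
        1 - c + e * x = x)"
    unfolding equilibria_def drift_eq by auto
  moreover have "1 - c + e * x = x \<longleftrightarrow> (e - 1) * x = c - 1"
    by (simp only: left_diff_distrib mult_1) linarith
  moreover have "x = 0 \<and> 1 - c + e * x \<le> 0 \<longleftrightarrow> x = 0 \<and> 1 \<le> c"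
    and "x = 1 \<and> 1 \<le> 1 - c + e * x \<longleftrightarrow> x = 1 \<and> c \<le> e"
    by auto
  ultimately show ?thesis by simp
qed

text \<open>Compared with the equilibria, the conditions at 0 and 1 become strict: for
  \<open>c = 1\<close> the point 0, and for \<open>c = e\<close> the point 1, is a fixed point and
  is governed by the slope \<open>e - 1\<close>.\<close>

lemma mem_stable_equilibria_iff:
  "x \<in> stable_equilibria M A c e \<longleftrightarrow>
     x \<in> {0..1} \<and> (x = 0 \<and> 1 < c \<or> x = 1 \<and> c < e \<or> (e - 1) * x = c - 1 \<and> e < 1)"
proof (cases "x \<in> equilibria M A c e")
  case False
  then show ?thesis
    by (auto simp: stable_equilibria_def mem_equilibria_iff)
next
  case True
  then have x: "0 \<le> x" "x \<le> 1" by (auto simp: mem_equilibria_iff)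
  \<comment> \<open>Here \<open>m\<close> is the room left before the clamping changes:
    \<open>c - 1\<close> at 0 and \<open>e - c\<close> at 1. Dividing by \<open>e + 1\<close>
    instead of \<open>e\<close> also covers \<open>e = 0\<close>.\<close>
  have small: "\<bar>e * z\<bar> \<le> m" if "\<bar>z\<bar> < m / (e + 1)" for z m
  proof -
    have "\<bar>z\<bar> * (e + 1) < m"
      using that e_nonneg by (simp add: pos_less_divide_eq)
    then show ?thesis using e_nonneg by (simp add: abs_mult algebra_simps)
  qed
  consider (zero) "x = 0" "1 < c" | (one) "x = 1" "c < e" | (fixpt) "(e - 1) * x = c - 1"
  proof -
    have "(e - 1) * x = c - 1" if "x = 0 \<and> c = 1 \<or> x = 1 \<and> e = c"
      using that by auto
    with True that show ?thesis
      unfolding mem_equilibria_iff le_less by blast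
  qed
  then show ?thesis
  proof cases
    case zero
    have "drift M A c e y = - 1 * y + 0" if "\<bar>y - x\<bar> < (c - 1) / (e + 1)" for y
      using small[OF that] zero by (simp add: drift_eq)
    then have "x \<in> stable_equilibria M A c e \<longleftrightarrow> (- 1 :: real) < 0"
      by (intro stable_equilibria_iff_slope[OF True, of "(c - 1) / (e + 1)"])
        (use zero e_nonneg in auto)
    with zero show ?thesis by simp
  next
    case one
    have "drift M A c e y = - 1 * y + 1" if "\<bar>y - x\<bar> < (e - c) / (e + 1)" for y
      using small[OF that] one by (simp add: drift_eq algebra_simps)
    then have "x \<in> stable_equilibria M A c e \<longleftrightarrow> (- 1 :: real) < 0"
      by (intro stable_equilibria_iff_slope[OF True, of "(e - c) / (e + 1)"])
        (use one e_nonneg in auto)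
    with one show ?thesis by simp
  next
    case fixpt
    \<comment> \<open>The distance from \<open>x\<close> to the end points other than
      \<open>x\<close> itself; the default 1 keeps \<open>m\<close> positive when \<open>x\<close>
      is an end point.\<close>
    define m where "m = min (if x = 0 then 1 else x) (if x = 1 then 1 else 1 - x)"
    have "m > 0" using x by (auto simp: m_def)
    have "drift M A c e y = (e - 1) * y + (1 - c)"
      if y: "y \<in> {0..1}" and "\<bar>y - x\<bar> < m / (e + 1)" for y
    proof -
      have u: "1 - c + e * y = x + e * (y - x)" using fixpt by (simp add: algebra_simps)
      have bounds: "- m \<le> e * (y - x)" "e * (y - x) \<le> m"
        using small[OF that(2)] by linarith+
      \<comment> \<open>At \<open>x = 0\<close> the sign of \<open>e * y\<close> suffices; elsewhere
        the margin \<open>m\<close> does. The upper bound is symmetric.\<close>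
      have "0 \<le> x + e * (y - x)"
      proof (cases "x = 0")
        case True
        then show ?thesis using y e_nonneg by simp
      next
        case False
        then have "m \<le> x" by (simp add: m_def)
        then show ?thesis using bounds by linarith
      qed
      moreover have "x + e * (y - x) \<le> 1"
      proof (cases "x = 1")
        case True
        then show ?thesis using y e_nonneg by (simp add: mult_nonneg_nonpos)
      next
        case False
        then have "m \<le> 1 - x" by (simp add: m_def)
        then show ?thesis using bounds by linarith
      qed
      ultimately show ?thesis
        using u unfolding drift_eq by (simp add: algebra_simps)
    qed
    then have "x \<in> stable_equilibria M A c e \<longleftrightarrow> e - 1 < 0"
      by (intro stable_equilibria_iff_slope[OF True, of "m / (e + 1)"])
        (use \<open>m > 0\<close> e_nonneg in auto)
    \<comment> \<open>A fixed point at 0 forces \<open>c = 1\<close> and one at 1 forces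
      \<open>c = e\<close>, so both strict alternatives fail.\<close>
    with fixpt x show ?thesis by auto
  qed
qed

end

lemma eq_x_circ_iff:
  assumes "e \<noteq> 1"
  shows "x = x_circ c e \<longleftrightarrow> (e - 1) * x = c - 1"
  using assms by (auto simp: x_circ_def field_simps)

text \<open>Strictness separates \<open>x_circ c e\<close> from 0 and 1, so that removing it leaves
  both end points.\<close>

lemma x_circ_mem_Ioo: "e < c \<Longrightarrow> c < 1 \<Longrightarrow> x_circ c e \<in> {0<..<1}"
  "1 < c \<Longrightarrow> c < e \<Longrightarrow> x_circ c e \<in> {0<..<1}"
  by (auto simp: x_circ_def field_simps)

theorem proposition5p2:
  fixes M :: "'w measure" and A :: "'w \<Rightarrow> real" and c e :: real
  assumes "prob_space M"
    and "distributed M lborel A (\<lambda>x. indicator {0..1::real} x / measure lborel {0..1::real})"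
    and "c \<ge> 0" and "e \<ge> 0"
  shows
    \<comment> \<open>the set of equilibria: main cases\<close>
    "(c > 1 \<and> c > e \<longrightarrow> equilibria M A c e = {0}) \<and>
     (e < c \<and> c < 1 \<longrightarrow> equilibria M A c e = {x_circ c e}) \<and>
     (1 < c \<and> c < e \<longrightarrow> equilibria M A c e = {0, x_circ c e, 1}) \<and>
     (c < 1 \<and> c < e \<longrightarrow> equilibria M A c e = {1}) \<and>
     \<comment> \<open>the set of equilibria: edge cases\<close>
     (c = 1 \<and> e = 1 \<longrightarrow> equilibria M A c e = {0..1}) \<and>
     (e < c \<and> c = 1 \<longrightarrow> equilibria M A c e = {0}) \<and>
     (c = e \<and> e < 1 \<longrightarrow> equilibria M A c e = {1}) \<and>
     ((1 < c \<and> c = e) \<or> (c = 1 \<and> 1 < e) \<longrightarrow> equilibria M A c e = {0, 1}) \<and>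
     \<comment> \<open>stability: main cases\<close>
     (c > 1 \<and> c > e \<longrightarrow> stable_equilibria M A c e = equilibria M A c e) \<and>
     (e < c \<and> c < 1 \<longrightarrow> stable_equilibria M A c e = equilibria M A c e) \<and>
     (1 < c \<and> c < e \<longrightarrow> stable_equilibria M A c e = equilibria M A c e - {x_circ c e}) \<and>
     (c < 1 \<and> c < e \<longrightarrow> stable_equilibria M A c e = equilibria M A c e) \<and>
     \<comment> \<open>stability: edge cases; in (i) no equilibrium is stable, and in (iv) the point
       \<open>x_circ c e\<close> coincides with 1 or 0 and is the unstable one\<close>
     (c = 1 \<and> e = 1 \<longrightarrow> stable_equilibria M A c e = {}) \<and>
     (e < c \<and> c = 1 \<longrightarrow> stable_equilibria M A c e = equilibria M A c e) \<and>
     (c = e \<and> e < 1 \<longrightarrow> stable_equilibria M A c e = equilibria M A c e) \<and>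
     ((1 < c \<and> c = e) \<or> (c = 1 \<and> 1 < e) \<longrightarrow>
        stable_equilibria M A c e = equilibria M A c e - {x_circ c e})"
proof -
  interpret uniform_adoption M A c e
    using assms by (simp add: uniform_adoption_def uniform_adoption_axioms_def)
  \<comment> \<open>For \<open>x\<close> in \<open>[0,1]\<close>, \<open>(e - 1) * x\<close> lies
    between 0 and \<open>e - 1\<close>, while \<open>c - 1\<close> lies strictly above both or
    strictly below both.\<close>
  have no_fixpt: "(e - 1) * x \<noteq> c - 1"
    if "x \<in> {0..1}" "c > 1 \<and> c > e \<or> c < 1 \<and> c < e" for x
  proof -
    have "min 0 (e - 1) \<le> (e - 1) * x \<and> (e - 1) * x \<le> max 0 (e - 1)"
      using that(1) mult_left_le[of x "e - 1"] mult_left_le[of x "1 - e"]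
        mult_nonneg_nonneg[of "e - 1" x] mult_nonneg_nonneg[of "1 - e" x]
      by (cases "e \<ge> 1") (auto simp: left_diff_distrib)
    then show ?thesis using that(2) by auto
  qed
  note mem = mem_equilibria_iff mem_stable_equilibria_iff
  note circ = eq_x_circ_iff[symmetric]
  show ?thesis
  proof (intro conjI impI, goal_cases)
    case 2
    then show ?case using x_circ_mem_Ioo(1)[of e c] unfolding set_eq_iff Diff_iff mem by (auto simp: circ)
  next
    case 3
    then show ?case using x_circ_mem_Ioo(2)[of c e] unfolding set_eq_iff Diff_iff mem by (auto simp: circ)
  next
    case 11
    then show ?case using x_circ_mem_Ioo(2)[of c e] unfolding set_eq_iff Diff_iff mem by (auto simp: circ)
  next
    case 16
    \<comment> \<open>The quotient evaluates to 1 if \<open>c = e\<close> and to 0 if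
      \<open>c = 1\<close>.\<close>
    then show ?case unfolding set_eq_iff Diff_iff mem by (auto simp: x_circ_def)
  qed (unfold set_eq_iff Diff_iff mem, use no_fixpt in auto)
qed

end
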